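(* (Spikes.) Write $\mathcal{G}(p_k^\#)=g_{k,1}g_{k,2}\cdots g_{k,\phi(p_k^\#)}$, with the second index read cyclically. Then, over the cycles of gaps, $$\limsup_{k\to\infty}\ \max_i \frac{g_{k,i+1}}{g_{k,i}}=\infty \quad\text{and}\quad \liminf_{k\to\infty}\ \min_i\frac{g_{k,i+1}}{g_{k,i}}=0 .$$ In particular, the gaps adjacent to a gap $2$ become arbitrarily large in later stages of the sieve: both $$\max\{g_{k,i+1} : g_{k,i}=2\}\quad\text{and}\quad \max\{g_{k,i-1} : g_{k,i}=2\}$$ tend to infinity as $k\to\infty$.
   Context: $p_k$ is the $k$-th prime ($p_1=2$). For a prime $p$, $p^\#$ denotes the primorial of $p$, the product of all primes from $2$ up to and including $p$. For an integer $N\ge 2$, the cycle of gaps $\mathcal{G}(N)=g_1 g_2\cdots g_{\phi(N)}$ is the cyclic sequence of differences between consecutive positive integers coprime to $N$, where $g_1$ is the difference between $1$ and the next larger integer coprime to $N$; it has $\phi(N)$ entries, which sum to $N$. *)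

theory Defs
  imports
    "HOL-Library.Infinite_Set"
    "HOL-Library.Extended_Real"
    "HOL-Library.Liminf_Limsup"
    "HOL-Number_Theory.Totient"
    Complex_Main
begin

text \<open>
  Primes are numbered from 1, so \<open>nth_prime 1 = 2\<close>; the library's \<open>enumerate\<close> numbers from 0.
  The value at \<open>k = 0\<close> is a junk value (again 2).
\<close>
definition nth_prime :: "nat \<Rightarrow> nat" where
  "nth_prime k = Infinite_Set.enumerate {p::nat. prime p} (k - 1)"

definition primorial :: "nat \<Rightarrow> nat" where
  "primorial p = \<Prod>{q::nat. prime q \<and> q \<le> p}"

definition coprimes :: "nat \<Rightarrow> nat set" where
  "coprimes N = {m. 0 < m \<and> coprime m N}"

text \<open>The natural-number subtraction is between consecutive terms of an increasing sequence.\<close>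
definition gap_cycle :: "nat \<Rightarrow> nat list" where
  "gap_cycle N =
     map (\<lambda>j. Infinite_Set.enumerate (coprimes N) (Suc j) - Infinite_Set.enumerate (coprimes N) j)
       [0..<totient N]"

text \<open>
  Gaps are numbered cyclically from 1: \<open>gap N 1\<close> is the head of the list, \<open>gap N 0\<close> its last
  entry, and \<open>gap N (totient N + 1) = gap N 1\<close>.
\<close>
definition gap :: "nat \<Rightarrow> int \<Rightarrow> nat" where
  "gap N i = gap_cycle N ! nat ((i - 1) mod int (length (gap_cycle N)))"

text \<open>\<open>sieve_gap k i\<close> is the gap \<open>g\<^sub>k\<^sub>,\<^sub>i\<close> of the cycle for the primorial of the \<open>k\<close>-th prime.\<close>
definition sieve_gap :: "nat \<Rightarrow> int \<Rightarrow> nat" where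
  "sieve_gap k i = gap (primorial (nth_prime k)) i"

definition gap_indices :: "nat \<Rightarrow> int set" where
  "gap_indices k = {1..int (totient (primorial (nth_prime k)))}"

end

theory Submission
  imports Defs
begin

text \<open>
  Fix \<open>M\<close> and attach to each offset \<open>j \<le> 2M + 2\<close> other than \<open>M\<close> and \<open>M + 2\<close> its own prime
  \<open>q\<^sub>j > 2M + 2\<close>. Once the sieve has passed all the \<open>q\<^sub>j\<close>, the Chinese remainder theorem gives \<open>z\<close>
  with \<open>q\<^sub>j dvd z + j\<close> for every such \<open>j\<close> and \<open>p dvd z + M + 1\<close> for all remaining primes \<open>p\<close> of the
  sieve. Then \<open>z + M\<close> and \<open>z + M + 2\<close> survive the sieve while all other numbers from \<open>z\<close> to
  \<open>z + 2M + 2\<close> are removed, so that a gap 2 has gaps larger than \<open>M\<close> on both of its sides.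
\<close>

section \<open>Primorials and the growth of the primes\<close>

lemma coprime_primorial_iff:
  "coprime m (primorial n) \<longleftrightarrow> (\<forall>p. prime p \<and> p \<le> n \<longrightarrow> \<not> p dvd m)"
proof -
  have fin: "finite {q::nat. prime q \<and> q \<le> n}"
    by (rule finite_subset[of _ "{..n}"]) auto
  show ?thesis
  proof
    assume c: "coprime m (primorial n)"
    show "\<forall>p. prime p \<and> p \<le> n \<longrightarrow> \<not> p dvd m"
    proof (intro allI impI notI)
      fix p assume p: "prime p \<and> p \<le> n" and "p dvd m"
      moreover have "p dvd primorial n"
        unfolding primorial_def using fin p by (intro dvd_prodI[where f = "\<lambda>q. q", simplified]) auto
      ultimately show False
        using c p by (meson coprime_common_divisor not_prime_unit)
    qed
  next
    assume a: "\<forall>p. prime p \<and> p \<le> n \<longrightarrow> \<not> p dvd m"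
    show "coprime m (primorial n)"
      unfolding primorial_def
    proof (rule prod_coprime_right)
      fix q assume "q \<in> {q. prime q \<and> q \<le> n}"
      then show "coprime m q"
        using a prime_imp_coprime coprime_commute by blast
    qed
  qed
qed

lemma primorial_ge_2:
  assumes "2 \<le> n"
  shows "2 \<le> primorial n"
proof -
  have "\<not> coprime 2 (primorial n)"
    using assms two_is_prime_nat dvd_refl coprime_primorial_iff[of 2 n] by metis
  moreover have "primorial n \<noteq> 0"
    unfolding primorial_def using prime_gt_0_nat by (subst prod_zero_iff) auto
  ultimately show ?thesis
    by (cases "primorial n = 1") auto
qed

text \<open>An increasing enumeration of naturals dominates its index. Hence every bound on the
  sieving primes is eventually passed.\<close>

lemma filterlim_nth_prime: "filterlim nth_prime at_top sequentially"
proof -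
  have "filterlim (\<lambda>k::nat. k - 1) at_top sequentially"
    by (rule filterlim_minus_const_nat_at_top)
  moreover have "k - 1 \<le> nth_prime k" for k
    unfolding nth_prime_def by (rule le_enumerate) (rule primes_infinite)
  ultimately show ?thesis
    by (auto intro: filterlim_at_top_mono)
qed

lemma nth_prime_ge_2: "2 \<le> nth_prime k"
  using enumerate_in_set[OF primes_infinite, of "k - 1"] prime_ge_2_nat
  unfolding nth_prime_def by auto

section \<open>Simultaneous congruences for the sieving primes\<close>

text \<open>The condition \<open>2 \<le> z\<close> leaves the survivor 1 below the block, so that
  \<open>z + M\<close> will have a predecessor among the survivors.\<close>

lemma isolated_twin_survivors:
  fixes M :: nat
  obtains B where "\<And>n. B \<le> n \<Longrightarrow> \<exists>z. 2 \<le> z \<and> coprime (z + M) (primorial n)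
     \<and> coprime (z + M + 2) (primorial n)
     \<and> (\<forall>j \<le> 2 * M + 2. j \<noteq> M \<longrightarrow> j \<noteq> M + 2 \<longrightarrow> \<not> coprime (z + j) (primorial n))"
proof -
  define L where "L = 2 * M + 2"
  define Q where "Q = {p::nat. prime p \<and> L < p}"
  define q where "q = Infinite_Set.enumerate Q"
  define J where "J = {..L} - {M, M + 2}"
  have infQ: "infinite Q"
    unfolding Q_def infinite_nat_iff_unbounded
    by (metis (mono_tags, lifting) bigger_prime mem_Collect_eq max_less_iff_conj)
  have qQ: "q j \<in> Q" for j
    unfolding q_def using infQ by (rule enumerate_in_set)
  have inj: "inj_on q A" for A
    unfolding q_def using infQ by (metis strict_mono_enumerate strict_mono_imp_inj_on)
  \<comment> \<open>\<open>c p\<close> is the offset that \<open>p\<close> has to strike. The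
    default \<open>M + 1\<close> is at distance 1 from both protected offsets, so even the prime 2
    spares them.\<close>
  define c where "c p = (if p \<in> q ` J then inv_into J q p else M + 1)" for p
  have c_q: "c (q j) = j" if "j \<in> J" for j
    using that inj by (auto simp: c_def)
  have c_other: "c p = M + 1 \<or> (L < p \<and> c p \<in> J)" for p
  proof (cases "p \<in> q ` J")
    case True
    then obtain j where "j \<in> J" "p = q j" by auto
    then show ?thesis using c_q[of j] qQ[of j] by (auto simp: Q_def)
  qed (simp add: c_def)
  define B where "B = max 2 (Max (insert 0 (q ` J)))"
  have main: "\<exists>z. 2 \<le> z \<and> coprime (z + M) (primorial n)
     \<and> coprime (z + M + 2) (primorial n)
     \<and> (\<forall>j \<le> 2 * M + 2. j \<noteq> M \<longrightarrow> j \<noteq> M + 2 \<longrightarrow> \<not> coprime (z + j) (primorial n))"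
    if n: "B \<le> n" for n
  proof -
    define P where "P = {p::nat. prime p \<and> p \<le> n}"
    have finP: "finite P"
      unfolding P_def by (rule finite_subset[of _ "{..n}"]) auto
    \<comment> \<open>\<open>c p * (p - 1)\<close> is a natural number standing for
      \<open>- c p\<close> modulo \<open>p\<close>.\<close>
    have "\<exists>x. \<forall>p\<in>P. [x = c p * (p - 1)] (mod p)"
      using finP by (intro chinese_remainder_nat) (auto simp: P_def primes_coprime)
    then obtain x where x: "\<And>p. p \<in> P \<Longrightarrow> [x = c p * (p - 1)] (mod p)"
      by blast
    \<comment> \<open>Adding a multiple of the primorial keeps all residues and forces
      \<open>2 \<le> z\<close>.\<close>
    define z where "z = x + 2 * primorial n"
    have dvdz: "p dvd z + c p" if p: "p \<in> P" for p
    proof -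
      have "p dvd primorial n"
        using p coprime_primorial_iff[of p n] prime_imp_coprime[of p "primorial n"]
        unfolding P_def by auto
      then have "[z + c p = c p * (p - 1) + 0 + c p] (mod p)"
        unfolding z_def using x[OF p]
        by (intro cong_add cong_refl) (auto simp: cong_0_iff)
      also have "c p * (p - 1) + 0 + c p = c p * p"
        using p prime_gt_0_nat[of p] unfolding P_def by (cases p) auto
      finally show ?thesis by (simp add: cong_dvd_iff)
    qed
    have cop: "coprime (z + d) (primorial n)" if d: "d = M \<or> d = M + 2" for d
      unfolding coprime_primorial_iff
    proof (intro allI impI notI)
      fix p assume p: "prime p \<and> p \<le> n" and "p dvd z + d"
      \<comment> \<open>The difference of the offsets is nonzero but too small to be divisible by
        \<open>p\<close>: it is 1 or -1 if \<open>c p = M + 1\<close>, and otherwise its absolute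
        value is at most \<open>L\<close>, with \<open>L < p\<close>.\<close>
      then have "int p dvd int (z + c p) - int (z + d)"
        using dvdz[of p] unfolding P_def by (intro dvd_diff) (simp_all only: int_dvd_int_iff mem_Collect_eq)
      then have dv: "int p dvd int (c p) - int d" by simp
      have ne: "int (c p) - int d \<noteq> 0"
        using c_other[of p] d by (auto simp: J_def)
      have "int p \<le> \<bar>int (c p) - int d\<bar>"
        using dvd_imp_le_int[OF ne dv] by simp
      moreover have "\<bar>int (c p) - int d\<bar> < int p"
        using c_other[of p] d p prime_ge_2_nat[of p] by (auto simp: J_def L_def)
      ultimately show False by simp
    qed
    have ncop: "\<not> coprime (z + j) (primorial n)" if "j \<le> 2 * M + 2" "j \<noteq> M" "j \<noteq> M + 2" for j
    proof -
      have j: "j \<in> J" using that by (auto simp: J_def L_def)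
      have "q j \<le> Max (insert 0 (q ` J))"
        using j by (intro Max_ge) (auto simp: J_def)
      then have "q j \<in> P"
        using n qQ[of j] unfolding P_def Q_def B_def by auto
      then show ?thesis
        using dvdz[of "q j"] c_q[OF j] unfolding coprime_primorial_iff P_def by auto
    qed
    have "2 \<le> z"
      using primorial_ge_2[of n] n unfolding z_def B_def by auto
    then show ?thesis
      using cop[of M] cop[of "M + 2"] ncop by (auto simp: add.assoc)
  qed
  then show ?thesis by (rule that)
qed

section \<open>Enumeration of the coprime numbers and periodicity of the gaps\<close>

text \<open>Allows the position of an element in the enumeration to be found by counting.\<close>

lemma card_less_enumerate:
  fixes S :: "nat set"
  assumes "infinite S"
  shows "card {y \<in> S. y < Infinite_Set.enumerate S j} = j"
proof -
  have "{y \<in> S. y < Infinite_Set.enumerate S j} = Infinite_Set.enumerate S ` {..<j}"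
  proof (intro equalityI subsetI)
    fix y assume y: "y \<in> {y \<in> S. y < Infinite_Set.enumerate S j}"
    then obtain i where "Infinite_Set.enumerate S i = y" using assms enumerate_Ex by blast
    then show "y \<in> Infinite_Set.enumerate S ` {..<j}" using y assms by auto
  qed (use assms in \<open>auto simp: enumerate_in_set\<close>)
  moreover have "inj_on (Infinite_Set.enumerate S) {..<j}"
    using assms by (metis strict_mono_enumerate strict_mono_imp_inj_on)
  ultimately show ?thesis by (simp add: card_image)
qed

lemma infinite_coprimes: "infinite (coprimes N)" if "0 < N"
proof -
  have "coprime (m * N + 1) N" for m
    by (metis coprime_1_right coprime_iff_gcd_eq_1 gcd.commute gcd_add_mult)
  then have "(\<lambda>m. m * N + 1) ` UNIV \<subseteq> coprimes N"
    unfolding coprimes_def by auto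
  moreover have "infinite (range (\<lambda>m. m * N + 1))"
    using that by (intro range_inj_infinite) (auto simp: inj_def)
  ultimately show ?thesis using finite_subset by blast
qed

text \<open>Translation by \<open>N\<close> preserves coprimality to \<open>N\<close>, and it passes
  over one full period containing \<open>totient N\<close> coprime numbers.\<close>

lemma enumerate_coprimes_add_totient:
  assumes N: "0 < N"
  shows "Infinite_Set.enumerate (coprimes N) (j + totient N) = Infinite_Set.enumerate (coprimes N) j + N"
proof -
  define C where "C = coprimes N"
  have inf: "infinite C" using infinite_coprimes[OF N] by (simp add: C_def)
  have shift: "coprime (y + N) N \<longleftrightarrow> coprime y N" for y
    by (simp add: coprime_iff_gcd_eq_1)
  define a where "a = Infinite_Set.enumerate C j"
  have "a \<in> C" unfolding a_def using inf by (rule enumerate_in_set)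
  then have a: "0 < a" "coprime a N" unfolding C_def coprimes_def by auto
  have "a + N \<in> C"
    using a unfolding C_def coprimes_def by (simp add: shift)
  then obtain i where i: "Infinite_Set.enumerate C i = a + N"
    using inf enumerate_Ex by metis
  \<comment> \<open>Split at \<open>N\<close>: the elements up to \<open>N\<close> are the
    totatives, those above are translates of the elements below \<open>a\<close>.\<close>
  have "{y \<in> C. y < a + N} = totatives N \<union> (\<lambda>y. y + N) ` {y \<in> C. y < a}" (is "?l = ?r")
  proof (intro equalityI subsetI)
    fix y assume y: "y \<in> ?l"
    show "y \<in> ?r"
    proof (cases "y \<le> N")
      case True
      then show ?thesis using y by (auto simp: C_def coprimes_def totatives_def)
    next
      case False
      then obtain w where "y = w + N" "0 < w" by (metis add.commute less_imp_add_positive not_le)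
      then show ?thesis using y by (auto simp: C_def coprimes_def shift)
    qed
  next
    fix y assume "y \<in> ?r"
    then show "y \<in> ?l"
      using a by (auto simp: C_def coprimes_def totatives_def shift)
  qed
  moreover have "totatives N \<inter> (\<lambda>y. y + N) ` {y \<in> C. y < a} = {}"
    by (auto simp: C_def coprimes_def totatives_def)
  ultimately have "card {y \<in> C. y < a + N} = totient N + card ((\<lambda>y. y + N) ` {y \<in> C. y < a})"
    by (simp add: card_Un_disjoint totient_def)
  also have "card ((\<lambda>y. y + N) ` {y \<in> C. y < a}) = card {y \<in> C. y < a}"
    by (intro card_image) simp
  also have "\<dots> = j" unfolding a_def using inf by (rule card_less_enumerate)
  finally have "i = j + totient N"
    using card_less_enumerate[OF inf, of i] i by simp
  then show ?thesis using i by (simp add: C_def a_def)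
qed

text \<open>By periodicity, reading the finite list cyclically agrees with taking differences along
  the infinite enumeration. The shift by 1 reconciles gaps numbered from 1 with
  \<open>enumerate\<close>, which starts at 0.\<close>

lemma gap_eq_enumerate_diff:
  assumes N: "0 < N"
  shows "gap N (int j + 1)
    = Infinite_Set.enumerate (coprimes N) (Suc j) - Infinite_Set.enumerate (coprimes N) j"
proof -
  define t where "t = totient N"
  have t: "0 < t" using N by (simp add: t_def)
  define d where "d j = Infinite_Set.enumerate (coprimes N) (Suc j) - Infinite_Set.enumerate (coprimes N) j" for j
  have per: "d (j + t) = d j" for j
    using enumerate_coprimes_add_totient[OF N, of j]
      enumerate_coprimes_add_totient[OF N, of "Suc j"]
    by (simp add: d_def t_def)
  have per': "d (r + m * t) = d r" for m r
  proof (induction m)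
    case (Suc m)
    have "d (r + Suc m * t) = d ((r + m * t) + t)" by (simp add: algebra_simps)
    then show ?case using Suc per by simp
  qed simp
  have "gap N (int j + 1) = d (j mod t)"
  proof -
    have "nat (int j mod int t) = j mod t" by (metis nat_int zmod_int)
    moreover have "j mod t < t" using t by simp
    ultimately show ?thesis unfolding gap_def gap_cycle_def t_def d_def by simp
  qed
  also have "\<dots> = d (j mod t + (j div t) * t)" by (rule per'[symmetric])
  also have "\<dots> = d j" by simp
  finally show ?thesis by (simp only: d_def)
qed

lemma gap_cong:
  assumes "[i = j] (mod int (totient N))"
  shows "gap N i = gap N j"
proof -
  have "(i - 1) mod int (totient N) = (j - 1) mod int (totient N)"
    using assms by (meson cong_def cong_diff cong_refl)
  then show ?thesis by (simp add: gap_def gap_cycle_def)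
qed

section \<open>Gaps 2 with large neighbours\<close>

lemma eventually_gap_2_between_large_gaps:
  "\<forall>\<^sub>F k in sequentially. \<exists>i. sieve_gap k i = 2 \<and> M < sieve_gap k (i + 1) \<and> M < sieve_gap k (i - 1)"
proof -
  obtain B where B: "\<And>n. B \<le> n \<Longrightarrow> \<exists>z. 2 \<le> z \<and> coprime (z + M) (primorial n)
     \<and> coprime (z + M + 2) (primorial n)
     \<and> (\<forall>j \<le> 2 * M + 2. j \<noteq> M \<longrightarrow> j \<noteq> M + 2 \<longrightarrow> \<not> coprime (z + j) (primorial n))"
    by (rule isolated_twin_survivors[of M]) blast
  have "\<forall>\<^sub>F k in sequentially. B \<le> nth_prime k"
    using filterlim_nth_prime by (auto simp: filterlim_at_top)
  then show ?thesis
  proof eventually_elim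
    case (elim k)
    define N where "N = primorial (nth_prime k)"
    have N: "0 < N" using primorial_ge_2[OF nth_prime_ge_2, of k] by (simp add: N_def)
    define C where "C = coprimes N"
    have inf: "infinite C" using infinite_coprimes[OF N] by (simp add: C_def)
    obtain z where z: "2 \<le> z" "coprime (z + M) N" "coprime (z + M + 2) N"
      and nz: "\<And>j. j \<le> 2 * M + 2 \<Longrightarrow> j \<noteq> M \<Longrightarrow> j \<noteq> M + 2 \<Longrightarrow> z + j \<notin> C"
      using B[OF elim] by (auto simp: N_def C_def coprimes_def)
    have inC: "z + M \<in> C" "z + M + 2 \<in> C" "1 \<in> C"
      using z by (auto simp: C_def coprimes_def)
    have survivor: "y < z \<or> y = z + M \<or> y = z + M + 2 \<or> z + 2 * M + 2 < y" if "y \<in> C" for y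
      using nz[of "y - z"] that by (cases "z \<le> y") force+
    let ?e = "Infinite_Set.enumerate C"
    have e_C: "?e j \<in> C" for j using inf by (rule enumerate_in_set)
    have e_less: "?e i < ?e j \<longleftrightarrow> i < j" for i j using inf by simp
    obtain j where j: "?e j = z + M" using inC(1) inf enumerate_Ex by metis
    obtain j' where j': "?e j' = z + M + 2" using inC(2) inf enumerate_Ex by metis
    obtain j0 where j0: "?e j0 = 1" using inC(3) inf enumerate_Ex by metis
    \<comment> \<open>The survivor 1 precedes \<open>z + M\<close>, so \<open>j\<close> is positive
      and the gap before \<open>z + M\<close> is a genuine difference of survivors.\<close>
    have "j0 < j" using e_less[of j0 j] j j0 z(1) by simp
    then obtain h where h: "j = Suc h" by (cases j) auto
    have "j < j'" using e_less[of j j'] j j' by simp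
    moreover have "\<not> Suc j < j'"
      using e_less[of "Suc j" j'] e_less[of j "Suc j"] j j' survivor[OF e_C, of "Suc j"] by auto
    ultimately have Sj: "?e (Suc j) = z + M + 2"
      using j' by (metis Suc_lessI)
    have 1: "sieve_gap k (int j + 1) = 2"
      using gap_eq_enumerate_diff[OF N, of j] Sj j by (simp add: sieve_gap_def N_def C_def)
    \<comment> \<open>The next survivor after the pair lies beyond the block and the previous one
      below \<open>z\<close>, each more than \<open>M\<close> away from the pair.\<close>
    have "z + 2 * M + 2 < ?e (Suc (Suc j))"
      using survivor[OF e_C, of "Suc (Suc j)"] e_less[of "Suc j" "Suc (Suc j)"] Sj by auto
    then have 2: "M < sieve_gap k (int j + 1 + 1)"
      using gap_eq_enumerate_diff[OF N, of "Suc j"] Sj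
      by (simp add: sieve_gap_def N_def C_def algebra_simps)
    have "?e h < z"
      using survivor[OF e_C, of h] e_less[of h "Suc h"] j h by auto
    then have 3: "M < sieve_gap k (int j + 1 - 1)"
      using gap_eq_enumerate_diff[OF N, of h] j h
      by (simp add: sieve_gap_def N_def C_def algebra_simps)
    show ?case using 1 2 3 by blast
  qed
qed

text \<open>An index taken from the infinite enumeration may lie outside the cycle. One
  representative serves all offsets \<open>d\<close>, so the neighbouring gaps are carried
  along.\<close>

lemma sieve_gap_reindex:
  obtains i' where "i' \<in> gap_indices k" "\<And>d. sieve_gap k (i' + d) = sieve_gap k (i + d)"
proof -
  define t where "t = int (totient (primorial (nth_prime k)))"
  have "0 < t" using primorial_ge_2[OF nth_prime_ge_2, of k] by (simp add: t_def)
  then have "0 \<le> (i - 1) mod t" "(i - 1) mod t < t" by simp_all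
  then have "(i - 1) mod t + 1 \<in> gap_indices k"
    unfolding gap_indices_def t_def[symmetric] atLeastAtMost_iff by linarith
  moreover have "sieve_gap k ((i - 1) mod t + 1 + d) = sieve_gap k (i + d)" for d
  proof -
    have "[(i - 1) mod t + (1 + d) = (i - 1) + (1 + d)] (mod t)"
      by (intro cong_add cong_refl) (simp add: cong_def)
    then show ?thesis
      unfolding sieve_gap_def by (intro gap_cong) (simp add: t_def algebra_simps)
  qed
  ultimately show ?thesis by (rule that)
qed

lemma eventually_spikes:
  "\<forall>\<^sub>F k in sequentially.
     (\<exists>i \<in> gap_indices k. sieve_gap k i = 2 \<and> M < sieve_gap k (i + 1) \<and> M < sieve_gap k (i - 1)) \<and>
     (\<exists>i \<in> gap_indices k. M < sieve_gap k i \<and> sieve_gap k (i + 1) = 2)"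
  using eventually_gap_2_between_large_gaps[of M]
proof eventually_elim
  case (elim k)
  then obtain i where i: "sieve_gap k i = 2" "M < sieve_gap k (i + 1)" "M < sieve_gap k (i - 1)"
    by blast
  obtain a where a: "a \<in> gap_indices k" "\<And>d. sieve_gap k (a + d) = sieve_gap k (i + d)"
    using sieve_gap_reindex[of k i] by blast
  \<comment> \<open>Reduced separately, since the predecessor of an index in
    \<open>gap_indices k\<close> can be 0.\<close>
  obtain b where b: "b \<in> gap_indices k" "\<And>d. sieve_gap k (b + d) = sieve_gap k (i - 1 + d)"
    using sieve_gap_reindex[of k "i - 1"] by blast
  show ?case
  proof (intro conjI)
    show "\<exists>i \<in> gap_indices k. sieve_gap k i = 2 \<and> M < sieve_gap k (i + 1) \<and> M < sieve_gap k (i - 1)"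
      using a(1) a(2)[of 0] a(2)[of 1] a(2)[of "-1"] i by auto
    show "\<exists>i \<in> gap_indices k. M < sieve_gap k i \<and> sieve_gap k (i + 1) = 2"
      using b(2)[of 0] b(2)[of 1] i by (intro bexI[OF _ b(1)]) simp
  qed
qed

section \<open>Passage to the limits\<close>

lemma filterlim_at_top_if_eventually_less:
  fixes f :: "nat \<Rightarrow> 'a::linorder"
  assumes "\<And>M. \<forall>\<^sub>F k in sequentially. M < f k"
  shows "filterlim f at_top sequentially"
  unfolding filterlim_at_top
proof
  fix Z
  show "\<forall>\<^sub>F k in sequentially. Z \<le> f k"
    using assms[of Z] by eventually_elim simp
qed

theorem mainTheorem4:
  shows "limsup (\<lambda>k. ereal (Max ((\<lambda>i. real (sieve_gap k (i + 1)) / real (sieve_gap k i)) ` gap_indices k))) = \<infinity>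
    \<and> liminf (\<lambda>k. ereal (Min ((\<lambda>i. real (sieve_gap k (i + 1)) / real (sieve_gap k i)) ` gap_indices k))) = 0
    \<and> filterlim (\<lambda>k. Max {sieve_gap k (i + 1) | i. i \<in> gap_indices k \<and> sieve_gap k i = 2}) at_top sequentially
    \<and> filterlim (\<lambda>k. Max {sieve_gap k (i - 1) | i. i \<in> gap_indices k \<and> sieve_gap k i = 2}) at_top sequentially"
proof (intro conjI)
  let ?r = "\<lambda>k i. real (sieve_gap k (i + 1)) / real (sieve_gap k i)"
  have fin: "finite (gap_indices k)" for k by (simp add: gap_indices_def)
  have fin': "finite {f i | i. i \<in> gap_indices k \<and> Q i}" for k and f :: "int \<Rightarrow> nat" and Q
    using fin by simp
  \<comment> \<open>More than the limsup: the maximal ratio itself tends to infinity, because a gap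
    above \<open>M\<close> following a gap 2 has ratio above \<open>M / 2\<close>.\<close>
  have "filterlim (\<lambda>k. Max (?r k ` gap_indices k)) at_top sequentially"
    unfolding filterlim_at_top
  proof
    fix Z :: real
    obtain M :: nat where M: "2 * Z < real M" using reals_Archimedean2 by blast
    show "\<forall>\<^sub>F k in sequentially. Z \<le> Max (?r k ` gap_indices k)"
      using eventually_spikes[of M]
    proof eventually_elim
      case (elim k)
      then obtain i where i: "i \<in> gap_indices k" "sieve_gap k i = 2" "M < sieve_gap k (i + 1)"
        by blast
      have "Z \<le> ?r k i" using i M by simp
      also have "\<dots> \<le> Max (?r k ` gap_indices k)" using i(1) fin by (intro Max_ge) auto
      finally show ?case .
    qed
  qed
  then show "limsup (\<lambda>k. ereal (Max (?r k ` gap_indices k))) = \<infinity>"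
    by (intro lim_imp_Limsup) (simp_all add: tendsto_PInfty_eq_at_top)
  \<comment> \<open>Likewise a full limit: a gap 2 following a gap above \<open>2 / e\<close> has
    ratio below \<open>e\<close>, and no ratio is negative.\<close>
  have "(\<lambda>k. Min (?r k ` gap_indices k)) \<longlonglongrightarrow> 0"
  proof (rule tendstoI)
    fix e :: real assume e: "0 < e"
    obtain M :: nat where M: "2 / e < real M" using reals_Archimedean2 by blast
    show "\<forall>\<^sub>F k in sequentially. dist (Min (?r k ` gap_indices k)) 0 < e"
      using eventually_spikes[of M]
    proof eventually_elim
      case (elim k)
      then obtain i where i: "i \<in> gap_indices k" "M < sieve_gap k i" "sieve_gap k (i + 1) = 2"
        by blast
      have "2 < e * real (sieve_gap k i)"
      proof -
        have "2 / e < real (sieve_gap k i)" using M i by linarith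
        then show ?thesis using e by (simp add: field_simps)
      qed
      then have "?r k i < e" using i by (simp add: field_simps)
      moreover have "Min (?r k ` gap_indices k) \<le> ?r k i" using i(1) fin by (intro Min_le) auto
      moreover have "0 \<le> Min (?r k ` gap_indices k)" using i(1) fin by (subst Min_ge_iff) auto
      ultimately show ?case by simp
    qed
  qed
  then show "liminf (\<lambda>k. ereal (Min (?r k ` gap_indices k))) = 0"
    by (intro lim_imp_Liminf) (simp_all add: zero_ereal_def)
  show "filterlim (\<lambda>k. Max {sieve_gap k (i + 1) | i. i \<in> gap_indices k \<and> sieve_gap k i = 2}) at_top sequentially"
  proof (rule filterlim_at_top_if_eventually_less)
    fix M
    show "\<forall>\<^sub>F k in sequentially. M < Max {sieve_gap k (i + 1) | i. i \<in> gap_indices k \<and> sieve_gap k i = 2}"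
      \<comment> \<open>The gap 2 obtained here also shows that the set is nonempty, so that
        \<open>Max\<close> is a true maximum for these \<open>k\<close>.\<close>
      using eventually_spikes[of M]
      by eventually_elim (subst Max_gr_iff[OF fin'], auto)
  qed
  show "filterlim (\<lambda>k. Max {sieve_gap k (i - 1) | i. i \<in> gap_indices k \<and> sieve_gap k i = 2}) at_top sequentially"
  proof (rule filterlim_at_top_if_eventually_less)
    fix M
    show "\<forall>\<^sub>F k in sequentially. M < Max {sieve_gap k (i - 1) | i. i \<in> gap_indices k \<and> sieve_gap k i = 2}"
      using eventually_spikes[of M]
      by eventually_elim (subst Max_gr_iff[OF fin'], auto)
  qed
qed

end
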